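(* Let $p$ be a prime and $n$ a positive integer, and let $b>1$ be an integer. If $N=p^n$ has a palindromic base-$b$ representation $N=(c_k,c_{k-1},\ldots,c_0)_b$ with $k$ odd, then $b=p^x-1$ for some integer $x$.
   Context: For an integer $b>1$, every positive integer $N$ can be written uniquely as $N=\sum_{i=0}^k c_i b^i$ with integers $0\le c_i<b$ and $c_k>0$; this is written $N=(c_k,\ldots,c_0)_b$. It is palindromic if $c_j=c_{k-j}$ for all $j=0,\ldots,k$. *)

theory Defs
  imports Complex_Main "HOL-Computational_Algebra.Primes"
begin

text \<open>
  A digit string (c k, ..., c 0) is a function on the natural numbers together with its top
  index \<open>k\<close>; the values of \<open>c\<close> beyond \<open>k\<close> are irrelevant.
\<close>

definition base_repr :: "nat \<Rightarrow> nat \<Rightarrow> nat \<Rightarrow> (nat \<Rightarrow> nat) \<Rightarrow> bool" where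
  "base_repr b N k c \<longleftrightarrow>
     (\<forall>i\<le>k. c i < b) \<and> c k > 0 \<and> N = (\<Sum>i\<le>k. c i * b ^ i)"

definition palindromic :: "nat \<Rightarrow> (nat \<Rightarrow> nat) \<Rightarrow> bool" where
  "palindromic k c \<longleftrightarrow> (\<forall>j\<le>k. c j = c (k - j))"

end

theory Submission
  imports Defs
begin

text \<open>
  Modulo \<open>b + 1\<close> a number is congruent to its alternating digit sum. For a palindrome with an even
  number of digits, reversing the digits changes the sign of this sum, so it vanishes. Hence
  \<open>b + 1\<close> divides \<open>p ^ n\<close> and is itself a power of \<open>p\<close>.
\<close>

text \<open>Since \<open>b\<close> is congruent to -1 modulo \<open>b + 1\<close>, so are their
  equal powers, and the claim follows term by term. Integers allow the signs.\<close>

lemma dvd_sum_digits_minus_alternating: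
  fixes b :: int and c :: "nat \<Rightarrow> int"
  shows "b + 1 dvd (\<Sum>i\<le>k. c i * b ^ i) - (\<Sum>i\<le>k. c i * (-1) ^ i)"
proof -
  \<comment> \<open>Writing the modulus as \<open>b - (-1)\<close> exposes the standard factor of a
    difference of powers.\<close>
  have "b - (-1) dvd b ^ i - (-1) ^ i" for i
    by (subst power_diff_sumr2) (rule dvd_triv_left)
  then have "b + 1 dvd c i * b ^ i - c i * (-1) ^ i" for i
    by (simp add: right_diff_distrib [symmetric])
  then show ?thesis
    by (simp add: sum_subtractf [symmetric] dvd_sum)
qed

lemma palindromic_alternating_sum:
  assumes "palindromic k c" and "odd k"
  shows "(\<Sum>i\<le>k. int (c i) * (-1) ^ i) = 0"
proof -
  have "(\<Sum>i\<le>k. int (c i) * (-1) ^ i) = (\<Sum>i\<le>k. int (c (k - i)) * (-1) ^ (k - i))"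
    by (rule sum.reindex_bij_witness [where i = "\<lambda>i. k - i" and j = "\<lambda>i. k - i"]) auto
  also have "\<dots> = (\<Sum>i\<le>k. - (int (c i) * (-1) ^ i))"
  proof (rule sum.cong)
    fix i assume "i \<in> {..k}"
    then have "i \<le> k" by simp
    moreover from this have "c (k - i) = c i"
      using assms(1) unfolding palindromic_def by metis
    \<comment> \<open>As \<open>k\<close> is odd, \<open>i\<close> and \<open>k - i\<close> have
      opposite parity.\<close>
    moreover have "(-1::int) ^ (k - i) = - ((-1) ^ i)"
      using \<open>i \<le> k\<close> \<open>odd k\<close> by (simp add: uminus_power_if)
    ultimately show "int (c (k - i)) * (-1) ^ (k - i) = - (int (c i) * (-1) ^ i)"
      by simp
  qed simp
  finally show ?thesis
    by (simp add: sum_negf)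
qed

lemma palindromic_base_repr_dvd:
  assumes "base_repr b N k c" and "palindromic k c" and "odd k"
  shows "b + 1 dvd N"
proof -
  have "int N = (\<Sum>i\<le>k. int (c i) * int b ^ i)"
    using assms(1) by (simp add: base_repr_def)
  then have "int b + 1 dvd int N"
    using dvd_sum_digits_minus_alternating [of "int b" "\<lambda>i. int (c i)" k]
      palindromic_alternating_sum [OF assms(2,3)] by simp
  then have "int (b + 1) dvd int N"
    by (simp add: add.commute)
  then show ?thesis
    by (simp only: of_nat_dvd_iff)
qed

theorem theorem3p1:
  fixes p n b N k :: nat and c :: "nat \<Rightarrow> nat"
  assumes "prime p" and "n > 0" and "b > 1"
    and "N = p ^ n"
    and "base_repr b N k c" and "palindromic k c"
    and "odd k"
  shows "\<exists>x::int. real b = real p powi x - 1"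
proof -
  have "b + 1 dvd p ^ n"
    using palindromic_base_repr_dvd assms by blast
  then obtain m where "b + 1 = p ^ m"
    using \<open>prime p\<close> by (auto simp: divides_primepow_nat)
  \<comment> \<open>Passing to the reals before subtracting 1 avoids truncated subtraction. The
    exponent \<open>x\<close> will be the natural number \<open>m\<close>.\<close>
  then have "real b + 1 = real p ^ m"
    by (simp flip: of_nat_power of_nat_Suc)
  then have "real b = real p powi int m - 1"
    by simp
  then show ?thesis ..
qed

end
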